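(* Let $\tau>0$, $\overline P^{SD}>0$, $\overline P^{SC}>0$, $\kappa\in(0,1]$, and $\eta^{SD}=\eta^{SC}=1$. Then the set of all $(e_{-},e,p)\in\mathbb{R}^3$ satisfying $$e=\kappa e_{-}-\max\{p,0\}\,\tau/\eta^{SD}-\min\{p,0\}\,\tau\eta^{SC},\qquad -\overline P^{SC}\le p\le\overline P^{SD}$$ equals the set of all $(e_{-},e,p)\in\mathbb{R}^3$ for which there exist $(p^{SD},p^{SC})\in\mathbb{R}^2$ such that $$p=p^{SD}-p^{SC},\quad 0\le p^{SD}\le\overline P^{SD},\quad 0\le p^{SC}\le\overline P^{SC},\quad e=\kappa e_{-}-p^{SD}\tau+p^{SC}\tau.$$
   Context: Here $e_{-}=e_{i(t-1)}^S$ and $e=e_{it}^S$ are the stored energies of a fixed energy storage system $i$ at the ends of periods $t-1$ and $t$, $p=p_{it}^S$ is its active power injection in period $t$, $p^{SD},p^{SC}$ are discharging and charging powers, $\eta^{SD},\eta^{SC}$ the discharging and charging efficiencies, $\kappa$ the dissipation parameter, and $\tau$ the period length. *)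

theory Defs
  imports Complex_Main
begin

end

theory Submission
  imports Defs
begin

text \<open>With unit efficiencies, charging and discharging convert energy at the same rate, so
  stored energy depends only on the net injection: since \<open>max p 0 + min p 0 = p\<close>, both
  descriptions reduce to \<open>e = \<kappa> * e_prev - p * \<tau>\<close> with \<open>p\<close>
  between \<open>- PSC_max\<close> and \<open>PSD_max\<close>. Simultaneous charging and discharging
  therefore adds no new points.\<close>

theorem lemma3:
  fixes \<tau> PSD_max PSC_max \<kappa> \<eta>SD \<eta>SC :: real
  assumes "\<tau> > 0" and "PSD_max > 0" and "PSC_max > 0" and "\<kappa> \<in> {0<..1}"
    and "\<eta>SD = 1" and "\<eta>SC = 1"
  shows "{(e_prev :: real, e :: real, p :: real).
            e = \<kappa> * e_prev - max p 0 * \<tau> / \<eta>SD - min p 0 * \<tau> * \<eta>SC \<and>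
            - PSC_max \<le> p \<and> p \<le> PSD_max}
       = {(e_prev :: real, e :: real, p :: real).
            \<exists>pSD pSC :: real.
              p = pSD - pSC \<and>
              0 \<le> pSD \<and> pSD \<le> PSD_max \<and>
              0 \<le> pSC \<and> pSC \<le> PSC_max \<and>
              e = \<kappa> * e_prev - pSD * \<tau> + pSC * \<tau>}"
proof -
  have net: "max p 0 * \<tau> / \<eta>SD + min p 0 * \<tau> * \<eta>SC = p * \<tau>" for p :: real
    using assms(5,6) by (simp add: max_def min_def)
  have "(e = \<kappa> * e_prev - max p 0 * \<tau> / \<eta>SD - min p 0 * \<tau> * \<eta>SC \<and>
          - PSC_max \<le> p \<and> p \<le> PSD_max) \<longleftrightarrow>
        (\<exists>pSD pSC. p = pSD - pSC \<and> 0 \<le> pSD \<and> pSD \<le> PSD_max \<and>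
          0 \<le> pSC \<and> pSC \<le> PSC_max \<and> e = \<kappa> * e_prev - pSD * \<tau> + pSC * \<tau>)"
    (is "?L \<longleftrightarrow> ?R") for e_prev e p :: real
  proof
    assume L: ?L
    show ?R
    proof (intro exI conjI)
      \<comment> \<open>This goal fixes the witnesses: the positive and negative parts of
        \<open>p\<close>, so at most one of them is nonzero.\<close>
      show "p = max p 0 - (- min p 0)" by simp
      show "e = \<kappa> * e_prev - max p 0 * \<tau> + (- min p 0) * \<tau>"
        using L assms(5,6) by simp
    \<comment> \<open>Positivity of the capacities covers the part of \<open>p\<close> that
      vanishes.\<close>
    qed (use L assms(2,3) in auto)
  next
    assume ?R
    then obtain pSD pSC where p: "p = pSD - pSC" "0 \<le> pSD" "pSD \<le> PSD_max"
        "0 \<le> pSC" "pSC \<le> PSC_max"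
      and e: "e = \<kappa> * e_prev - pSD * \<tau> + pSC * \<tau>"
      by blast
    \<comment> \<open>Any overlap of \<open>pSD\<close> and \<open>pSC\<close> cancels here.\<close>
    have "e = \<kappa> * e_prev - p * \<tau>"
      unfolding p(1) e by (simp add: algebra_simps)
    then show ?L
      \<comment> \<open>The bounds on \<open>p\<close> follow from
        \<open>- pSC \<le> p \<le> pSD\<close>.\<close>
      using net[of p] p by linarith
  qed
  then show ?thesis by simp
qed

end
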